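(* Let $M$ be an MT-algebra, let $\mathscr A(M)$ be its Alexandroff extension, and let $\pi:\mathscr A(M)\to M$ be the projection $\pi(a,b)=a$. If $M$ is not compact, then $(\mathscr A(M),\pi)$ is a compactification of $M$.
   Context: An MT-algebra is a pair $(M,\square)$, where $M$ is a complete Boolean algebra and $\square:M\to M$ satisfies $\square 1=1$, $\square(a\wedge b)=\square a\wedge\square b$, $\square a\le a$, $\square a\le\square\square a$. An element $a$ is open if $a=\square a$; $\mathcal O(M)$ is the set (a frame) of open elements. An MT-morphism $h:N\to M$ is a complete Boolean homomorphism with $h(\square a)\le\square h(a)$ for all $a$; it restricts to a frame homomorphism $\mathcal O(h):\mathcal O(N)\to\mathcal O(M)$. An element $a\in M$ is compact if whenever $a\le\bigvee S$ with $S\subseteq\mathcal O(M)$, there is a finite $T\subseteq S$ with $a\le\bigvee T$; $M$ is compact if $1$ is compact. An MT-morphism $h:N\to M$ is dense if $h(u)=0$ implies $u=0$ for every $u\in\mathcal O(N)$, and is an MT-embedding if both $h$ and $\mathcal O(h)$ are onto. A compactification of $M$ is a pair $(N,h)$ with $N$ a compact MT-algebra and $h:N\to M$ a dense MT-embedding. The Alexandroff extension of $M$ is the MT-algebra $\mathscr A(M)=M\times 2$ (where $2$ is the two-element Boolean algebra) with operator $\square(a,b)=(\square a,b)$ if $\neg\square a$ is compact in $M$, and $\square(a,b)=(\square a,0)$ otherwise. *)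

theory Defs
  imports "HOL-Library.Product_Order"
begin

text \<open>
  A complete Boolean algebra is a type of sort \<open>{boolean_algebra, complete_lattice}\<close>.
  The library class \<open>complete_boolean_algebra\<close> is not suitable: it demands complete
  distributivity, so it only covers the atomic complete Boolean algebras.
\<close>

locale mt_algebra =
  fixes box :: "'a::{boolean_algebra, complete_lattice} \<Rightarrow> 'a"
  assumes box_top: "box top = top"
    and box_inf: "box (inf a b) = inf (box a) (box b)"
    and box_le: "box a \<le> a"
    and box_le_box_box: "box a \<le> box (box a)"

definition opens :: "('a::{boolean_algebra, complete_lattice} \<Rightarrow> 'a) \<Rightarrow> 'a set" where
  "opens box = {a. a = box a}"

definition compact_element ::
  "('a::{boolean_algebra, complete_lattice} \<Rightarrow> 'a) \<Rightarrow> 'a \<Rightarrow> bool" where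
  "compact_element box a \<longleftrightarrow>
     (\<forall>S. S \<subseteq> opens box \<longrightarrow> a \<le> Sup S \<longrightarrow> (\<exists>T. finite T \<and> T \<subseteq> S \<and> a \<le> Sup T))"

locale compact_mt_algebra = mt_algebra +
  assumes compact_top: "compact_element box top"

text \<open>Preservation of the binary operations and of the bounds is the case of finite sets.\<close>

definition complete_boolean_hom ::
  "('b::{boolean_algebra, complete_lattice} \<Rightarrow> 'a::{boolean_algebra, complete_lattice}) \<Rightarrow> bool"
  where
  "complete_boolean_hom h \<longleftrightarrow>
     (\<forall>A. h (Sup A) = Sup (h ` A)) \<and> (\<forall>A. h (Inf A) = Inf (h ` A)) \<and> (\<forall>a. h (- a) = - h a)"

text \<open>Morphisms go from the algebra with operator \<open>boxN\<close> to the one with operator \<open>boxM\<close>.\<close>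

locale mt_morphism = N: mt_algebra boxN + M: mt_algebra boxM
  for boxN :: "'b::{boolean_algebra, complete_lattice} \<Rightarrow> 'b"
    and boxM :: "'a::{boolean_algebra, complete_lattice} \<Rightarrow> 'a" +
  fixes h :: "'b \<Rightarrow> 'a"
  assumes hom: "complete_boolean_hom h"
    and box_hom_le: "h (boxN a) \<le> boxM (h a)"

locale dense_mt_morphism = mt_morphism +
  assumes dense: "u \<in> opens boxN \<Longrightarrow> h u = bot \<Longrightarrow> u = bot"

text \<open>
  A morphism maps open elements to open elements; \<open>opens_onto\<close> says that its restriction to
  the open elements is onto the open elements of the target.
\<close>

locale mt_embedding = mt_morphism +
  assumes onto: "surj h"
    and opens_onto: "h ` opens boxN = opens boxM"

locale mt_compactification =
  compact_mt_algebra boxN + dense_mt_morphism boxN boxM h + mt_embedding boxN boxM h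
  for boxN :: "'b::{boolean_algebra, complete_lattice} \<Rightarrow> 'b"
    and boxM :: "'a::{boolean_algebra, complete_lattice} \<Rightarrow> 'a"
    and h :: "'b \<Rightarrow> 'a"

text \<open>The two-element Boolean algebra is \<open>bool\<close>; the order on the product is componentwise.\<close>

definition alexandroff_box ::
  "('a::{boolean_algebra, complete_lattice} \<Rightarrow> 'a) \<Rightarrow> 'a \<times> bool \<Rightarrow> 'a \<times> bool" where
  "alexandroff_box box = (\<lambda>(a, b).
     if compact_element box (- box a) then (box a, b) else (box a, False))"

end

theory Submission
  imports Defs
begin

text \<open>
  In \<open>alexandroff_box box\<close> an open element with second component \<open>True\<close> is an open element of the
  original algebra with compact complement, so it covers all but a compact part. Every open cover
  of the top contains such an element, and finitely many further members cover the rest.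
  The operator preserves binary meets because compact elements are closed under binary joins
  and under passing to smaller closed elements. Density is exactly noncompactness: the point
  \<open>(bot, True)\<close> is open only if the top is compact.
\<close>

lemma compact_element_bot: "compact_element box bot"
  unfolding compact_element_def by (metis bot_least empty_subsetI finite.emptyI)

lemma compact_element_sup:
  assumes "compact_element box a" and "compact_element box b"
  shows "compact_element box (sup a b)"
  unfolding compact_element_def
proof (intro allI impI)
  fix S assume S: "S \<subseteq> opens box" "sup a b \<le> Sup S"
  then obtain T U where "finite T" "T \<subseteq> S" "a \<le> Sup T" "finite U" "U \<subseteq> S" "b \<le> Sup U"
    using assms unfolding compact_element_def by (meson le_sup_iff)
  then have "finite (T \<union> U) \<and> T \<union> U \<subseteq> S \<and> sup a b \<le> Sup (T \<union> U)"
    by (auto simp: Sup_union_distrib intro: le_supI1 le_supI2)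
  then show "\<exists>T. finite T \<and> T \<subseteq> S \<and> sup a b \<le> Sup T" by blast
qed

lemma compact_element_closed_le:
  assumes k: "compact_element box k" and c: "- c \<in> opens box" and le: "c \<le> k"
  shows "compact_element box c"
  unfolding compact_element_def
proof (intro allI impI)
  fix S assume S: "S \<subseteq> opens box" "c \<le> Sup S"
  have "sup (- c) (Sup S) = top"
    using S(2) by (simp add: sup_shunt)
  then have "k \<le> Sup (insert (- c) S)" by simp
  moreover have "insert (- c) S \<subseteq> opens box"
    using S(1) c by simp
  ultimately obtain T where T: "finite T" "T \<subseteq> insert (- c) S" "k \<le> Sup T"
    using k unfolding compact_element_def by blast
  let ?T = "T - {- c}"
  \<comment> \<open>Only an inequality, since \<open>- c\<close> need not belong to
    \<open>T\<close>.\<close>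
  have "Sup T \<le> Sup (insert (- c) ?T)"
    by (rule Sup_subset_mono) blast
  with le T(3) have "c \<le> Sup (insert (- c) ?T)"
    by (meson order_trans)
  then have "c \<le> Sup ?T"
    \<comment> \<open>Moving \<open>- c\<close> across the inequality leaves \<open>inf c c\<close>
      on the left.\<close>
    unfolding Sup_insert shunt1[symmetric] by simp
  then show "\<exists>T. finite T \<and> T \<subseteq> S \<and> c \<le> Sup T"
    using T by (intro exI[of _ ?T]) auto
qed

context mt_algebra
begin

lemma box_box: "box (box a) = box a"
  by (simp add: antisym box_le box_le_box_box)

text \<open>The join is \<open>- box (inf a b)\<close>, so this matches the case distinctions of
  \<open>alexandroff_box\<close> on the two sides of the meet law. From left to right, each
  \<open>- box a\<close> has an open complement and lies below the join.\<close>

lemma compact_element_sup_compl_box_iff: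
  "compact_element box (sup (- box a) (- box b)) \<longleftrightarrow>
     compact_element box (- box a) \<and> compact_element box (- box b)"
proof
  assume "compact_element box (sup (- box a) (- box b))"
  then show "compact_element box (- box a) \<and> compact_element box (- box b)"
    by (intro conjI; elim compact_element_closed_le) (simp_all add: opens_def box_box)
qed (simp add: compact_element_sup)

lemma mt_algebra_alexandroff: "mt_algebra (alexandroff_box box)"
proof
  show "alexandroff_box box top = top"
    by (simp add: alexandroff_box_def top_prod_def box_top compact_element_bot)
  show "alexandroff_box box (inf x y) = inf (alexandroff_box box x) (alexandroff_box box y)" for x y
    by (cases x; cases y) (simp add: alexandroff_box_def compact_element_sup_compl_box_iff box_inf)
  show "alexandroff_box box x \<le> x" for x
    by (cases x) (simp add: alexandroff_box_def box_le)
  \<comment> \<open>By \<open>box_box\<close>, the compactness test has the same outcome at the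
    second application.\<close>
  show "alexandroff_box box x \<le> alexandroff_box box (alexandroff_box box x)" for x
    by (cases x) (simp add: alexandroff_box_def box_box)
qed

lemma mem_opens_alexandroff:
  "(a, b) \<in> opens (alexandroff_box box) \<longleftrightarrow>
     a \<in> opens box \<and> (b \<longrightarrow> compact_element box (- a))"
  by (auto simp: opens_def alexandroff_box_def split: if_splits)

lemma fst_opens_alexandroff: "fst ` opens (alexandroff_box box) = opens box"
proof
  show "fst ` opens (alexandroff_box box) \<subseteq> opens box"
    by (auto simp: mem_opens_alexandroff)
  show "opens box \<subseteq> fst ` opens (alexandroff_box box)"
  proof
    fix a assume "a \<in> opens box"
    \<comment> \<open>The component \<open>False\<close> carries no compactness condition, so every
      open element lifts.\<close>
    then have "(a, False) \<in> opens (alexandroff_box box)"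
      by (simp add: mem_opens_alexandroff)
    then show "a \<in> fst ` opens (alexandroff_box box)" by force
  qed
qed

lemma compact_element_alexandroff_top: "compact_element (alexandroff_box box) top"
  unfolding compact_element_def
proof (intro allI impI)
  fix S assume S: "S \<subseteq> opens (alexandroff_box box)" and "top \<le> Sup S"
  then have top: "Sup S = top" by (simp add: top.extremum_unique)
  then have "Sup (snd ` S)"
    using snd_Sup[of S] by simp
  \<comment> \<open>A supremum in \<open>bool\<close> is true only if some member is.\<close>
  then obtain u where u: "(u, True) \<in> S" by auto
  then have "compact_element box (- u)"
    using S mem_opens_alexandroff[of u True] by auto
  moreover have "fst ` S \<subseteq> opens box"
    unfolding fst_opens_alexandroff[symmetric] using S by (rule image_mono)
  moreover have "- u \<le> Sup (fst ` S)"
    using top fst_Sup[of S] by simp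
  ultimately obtain T where T: "finite T" "T \<subseteq> fst ` S" "- u \<le> Sup T"
    unfolding compact_element_def by meson
  \<comment> \<open>\<open>T\<close> consists of first components only; \<open>U\<close> picks
    finitely many members of \<open>S\<close> above them.\<close>
  then obtain U where U: "U \<subseteq> S" "finite U" "T = fst ` U"
    by (meson finite_subset_image)
  have "sup u (Sup T) = top"
    using T(3) by (simp add: sup_shunt)
  \<comment> \<open>The pair \<open>(u, True)\<close> alone settles the second component.\<close>
  then have "top \<le> Sup (insert (u, True) U)"
    using U(3) by (simp add: less_eq_prod_def fst_Sup)
  then show "\<exists>T. finite T \<and> T \<subseteq> S \<and> top \<le> Sup T"
    using u U by (intro exI[of _ "insert (u, True) U"]) auto
qed

end

theorem theorem3p16:
  fixes box :: "'a::{boolean_algebra, complete_lattice} \<Rightarrow> 'a"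
  assumes "mt_algebra box"
    and "\<not> compact_mt_algebra box"
  shows "mt_compactification (alexandroff_box box) box (fst :: 'a \<times> bool \<Rightarrow> 'a)"
proof -
  interpret M: mt_algebra box by (rule assms(1))
  interpret A: mt_algebra "alexandroff_box box" by (rule M.mt_algebra_alexandroff)
  have not_compact: "\<not> compact_element box top"
    using assms by (simp add: compact_mt_algebra_def compact_mt_algebra_axioms_def)
  show ?thesis
  proof
    show "compact_element (alexandroff_box box) top"
      by (rule M.compact_element_alexandroff_top)
    show "complete_boolean_hom (fst :: 'a \<times> bool \<Rightarrow> 'a)"
      by (simp add: complete_boolean_hom_def fst_Sup fst_Inf)
    show "fst (alexandroff_box box x) \<le> box (fst x)" for x
      by (cases x) (simp add: alexandroff_box_def)
    show "u = bot" if "u \<in> opens (alexandroff_box box)" "fst u = bot" for u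
      using that not_compact by (cases u) (auto simp: M.mem_opens_alexandroff bot_prod_def)
    show "surj (fst :: 'a \<times> bool \<Rightarrow> 'a)"
      by (simp add: surj_def)
    show "fst ` opens (alexandroff_box box) = opens box"
      by (rule M.fst_opens_alexandroff)
  qed
qed

end
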